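(* Let $G_1:=\langle\mathrm{Alt}(\mathbb{Z}),t\rangle$ and $G_2:=\langle\mathrm{Alt}(\mathbb{Z}),t^2\rangle$, as subgroups of $\mathrm{Sym}(\mathbb{Z})$. No finite total dominating set exists for $G_1$, and no finite total dominating set exists for $G_2$.
   Context: $\mathrm{Sym}(\mathbb{Z})$ is the group of all bijections of $\mathbb{Z}$, acting on the right (so products are composed left to right). $\mathrm{Alt}(\mathbb{Z})$ is the group of all even permutations of $\mathbb{Z}$ moving only finitely many points. $t\in\mathrm{Sym}(\mathbb{Z})$ is the translation $z\mapsto z+1$. A subset $X$ of a group $G$ is a total dominating set of $G$ if for every $g\in G\setminus\{1\}$ there exists $h\in X$ such that $\langle g,h\rangle=G$. *)

theory Defs
  imports "HOL-Algebra.Generated_Groups" "HOL-Combinatorics.Permutations"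
begin

text \<open>Permutations act on the right, so the product of f and g is ``first f, then g''
  (the opposite of the convention of BijGroup in HOL-Algebra).\<close>

definition Sym_int :: "(int \<Rightarrow> int) monoid" where
  "Sym_int = \<lparr>carrier = {f. bij f}, monoid.mult = (\<lambda>f g. g \<circ> f), one = id\<rparr>"

lemma group_Sym_int: "group Sym_int"
proof (rule groupI)
  fix f assume "f \<in> carrier Sym_int"
  then have "bij f" by (simp add: Sym_int_def)
  then have "inv_into UNIV f \<circ> f = id" "f \<circ> inv_into UNIV f = id" "bij (inv_into UNIV f)"
    by (auto simp: bij_imp_bij_inv bij_is_inj surj_iff[symmetric] bij_is_surj)
  then show "\<exists>g\<in>carrier Sym_int. g \<otimes>\<^bsub>Sym_int\<^esub> f = \<one>\<^bsub>Sym_int\<^esub>"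
    by (auto simp: Sym_int_def)
qed (auto simp: Sym_int_def bij_comp o_assoc)

definition Alt_int :: "(int \<Rightarrow> int) set" where
  "Alt_int = {p \<in> carrier Sym_int. finite {z. p z \<noteq> z} \<and> evenperm p}"

definition transl :: "int \<Rightarrow> int" where
  "transl z = z + 1"

lemma transl_in_Sym_int: "transl \<in> carrier Sym_int"
  unfolding Sym_int_def transl_def
  by (auto intro!: bij_betw_byWitness[where f' = "\<lambda>z. z - 1"])

lemma transl_square: "(transl [^]\<^bsub>Sym_int\<^esub> (2::nat)) z = z + 2"
  by (simp add: nat_pow_def numeral_2_eq_2 Sym_int_def transl_def)

definition G1 :: "(int \<Rightarrow> int) monoid" where
  "G1 = subgroup_generated Sym_int (Alt_int \<union> {transl})"

definition G2 :: "(int \<Rightarrow> int) monoid" where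
  "G2 = subgroup_generated Sym_int (Alt_int \<union> {transl [^]\<^bsub>Sym_int\<^esub> (2::nat)})"

definition total_dominating_set :: "('a, 'b) monoid_scheme \<Rightarrow> 'a set \<Rightarrow> bool" where
  "total_dominating_set G S \<longleftrightarrow>
     S \<subseteq> carrier G \<and>
     (\<forall>g \<in> carrier G - {\<one>\<^bsub>G\<^esub>}. \<exists>h \<in> S. generate G {g, h} = carrier G)"

end

theory Submission
  imports Defs
begin

text \<open>
  Let \<open>k > 0\<close> and let \<open>G\<close> be generated by the finitary alternating group and the translation
  \<open>z \<mapsto> z + k\<close>; the two groups in question are the cases \<open>k = 1\<close> and \<open>k = 2\<close>. Given finitely many
  candidates \<open>h\<close>, some nontrivial \<open>g\<close> generates \<open>G\<close> with none of them: a
  3-cycle on three points of the progression \<open>2k\<int>\<close>, placed far out towards \<open>+\<infinity>\<close>.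

  Every \<open>h \<in> G\<close> agrees with some translation \<open>z \<mapsto> z + d\<close>, \<open>k dvd d\<close>, near \<open>+\<infinity>\<close>; call \<open>d\<close> its
  drift. Drift is additive and vanishes on the alternating group.

  \<^item> If \<open>d \<noteq> \<plusminus>k\<close>, all elements of \<open>\<langle>g, h\<rangle>\<close> have drift divisible by \<open>d\<close>, which
    excludes \<open>z \<mapsto> z + k\<close>.

  \<^item> If \<open>d = \<plusminus>k\<close>, then near \<open>+\<infinity>\<close> the map \<open>h\<close> exchanges the residue classes of \<open>0\<close> and \<open>k\<close>
    modulo \<open>2k\<close>. Pulling back along \<open>h\<close> extends these to sets \<open>A, B \<subseteq> \<int>\<close> with \<open>h(A) = B\<close> and
    \<open>h(B) = A\<close> (lemma \<open>parity_classes\<close>). Once \<open>g\<close> lies far enough out, its three points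
    are in \<open>A\<close> and outside \<open>B\<close>, so \<open>g\<close> fixes both sets and \<open>\<langle>g, h\<rangle>\<close> stabilises the pair
    \<open>{A, B}\<close>. The alternating group does not: a far-out 3-cycle \<open>(b, b + k, b + 2k)\<close> with
    \<open>2k dvd b\<close> moves one point of \<open>A\<close> out of \<open>A\<close> and another point of \<open>A\<close> to a point outside \<open>B\<close>.

  ``Far enough'' depends on \<open>h\<close>, but finitely many \<open>h\<close> have a common bound; this
  is where finiteness of the dominating set enters.
\<close>

section \<open>Subgroups of the symmetric group on the integers\<close>

definition setwise_stabiliser :: "int set set \<Rightarrow> (int \<Rightarrow> int) set" where
  "setwise_stabiliser \<B> = {f. bij f \<and> (\<lambda>A. f ` A) ` \<B> = \<B>}"

text \<open>Only the behaviour at \<open>+\<infinity>\<close> is recorded: on a group generated by the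
  alternating group and a nontrivial translation it already determines the image in the infinite
  cyclic quotient by the alternating group.\<close>

definition drift_group :: "int \<Rightarrow> (int \<Rightarrow> int) set" where
  "drift_group a = {f. bij f \<and> (\<exists>d. a dvd d \<and> (\<exists>N. \<forall>z>N. f z = z + d))}"

lemma inv_Sym_int:
  assumes "bij f"
  shows "inv\<^bsub>Sym_int\<^esub> f = inv_into UNIV f"
proof (rule group.inv_equality[OF group_Sym_int])
  show "inv_into UNIV f \<otimes>\<^bsub>Sym_int\<^esub> f = \<one>\<^bsub>Sym_int\<^esub>"
    using assms by (auto simp: Sym_int_def surj_iff[symmetric] bij_is_surj)
qed (use assms in \<open>auto simp: Sym_int_def bij_imp_bij_inv\<close>)

lemma subgroup_Sym_intI:
  assumes "\<And>f. f \<in> H \<Longrightarrow> bij f" and "id \<in> H"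
    and "\<And>f g. f \<in> H \<Longrightarrow> g \<in> H \<Longrightarrow> g \<circ> f \<in> H"
    and "\<And>f. f \<in> H \<Longrightarrow> inv_into UNIV f \<in> H"
  shows "subgroup H Sym_int"
proof (rule group.subgroupI[OF group_Sym_int])
  show "H \<subseteq> carrier Sym_int" using assms(1) by (auto simp: Sym_int_def)
  show "H \<noteq> {}" using assms(2) by auto
  show "inv\<^bsub>Sym_int\<^esub> f \<in> H" if "f \<in> H" for f
    using that assms by (simp add: inv_Sym_int)
  show "f \<otimes>\<^bsub>Sym_int\<^esub> g \<in> H" if "f \<in> H" "g \<in> H" for f g
    using that assms(3) by (simp add: Sym_int_def)
qed

lemma subgroup_setwise_stabiliser: "subgroup (setwise_stabiliser \<B>) Sym_int"
proof (rule subgroup_Sym_intI)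
  fix f g assume f: "f \<in> setwise_stabiliser \<B>" and g: "g \<in> setwise_stabiliser \<B>"
  have "(\<lambda>A. (g \<circ> f) ` A) ` \<B> = (\<lambda>A. g ` A) ` ((\<lambda>A. f ` A) ` \<B>)"
    by (simp add: image_image image_comp)
  then show "g \<circ> f \<in> setwise_stabiliser \<B>"
    using f g by (simp add: setwise_stabiliser_def bij_comp)
next
  fix f assume f: "f \<in> setwise_stabiliser \<B>"
  then have bij: "bij f" and B: "(\<lambda>A. f ` A) ` \<B> = \<B>"
    by (auto simp: setwise_stabiliser_def)
  have "(\<lambda>A. inv_into UNIV f ` A) ` \<B> = (\<lambda>A. inv_into UNIV f ` A) ` ((\<lambda>A. f ` A) ` \<B>)"
    by (simp only: B)
  also have "\<dots> = \<B>"
    using bij by (simp add: image_image bij_is_inj)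
  finally show "inv_into UNIV f \<in> setwise_stabiliser \<B>"
    using bij by (simp add: setwise_stabiliser_def bij_imp_bij_inv)
qed (auto simp: setwise_stabiliser_def)

lemma not_in_setwise_stabiliser:
  assumes "A \<in> \<B>" "f ` A \<notin> \<B>"
  shows "f \<notin> setwise_stabiliser \<B>"
  using assms by (auto simp: setwise_stabiliser_def)

lemma subgroup_drift_group: "subgroup (drift_group a) Sym_int"
proof (rule subgroup_Sym_intI)
  fix f g assume "f \<in> drift_group a" "g \<in> drift_group a"
  then obtain d M e N where bij: "bij f" "bij g" and dvd: "a dvd d" "a dvd e"
    and M: "\<forall>z>M. f z = z + d" and N: "\<forall>z>N. g z = z + e"
    by (auto simp: drift_group_def)
  have "\<forall>z>max M (N - d). (g \<circ> f) z = z + (d + e)"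
    using M N by auto
  then show "g \<circ> f \<in> drift_group a"
    using bij dvd unfolding drift_group_def by (blast intro: bij_comp dvd_add)
next
  fix f assume "f \<in> drift_group a"
  then obtain d N where bij: "bij f" and dvd: "a dvd d" and N: "\<forall>z>N. f z = z + d"
    by (auto simp: drift_group_def)
  have "inv_into UNIV f z = z + (- d)" if "z > N + d" for z
    using N that bij by (intro inv_f_eq) (auto simp: bij_is_inj)
  then show "inv_into UNIV f \<in> drift_group a"
    using bij dvd unfolding drift_group_def by (blast intro: bij_imp_bij_inv dvd_minus_iff[THEN iffD2])
qed (auto simp: drift_group_def intro: exI[of _ 0])

lemma translation_in_drift_group_iff: "(\<lambda>z. z + k) \<in> drift_group a \<longleftrightarrow> a dvd k"
proof
  assume "(\<lambda>z. z + k) \<in> drift_group a"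
  then obtain d N where d: "a dvd d" and N: "\<forall>z>N. z + k = z + d"
    unfolding drift_group_def by blast
  have "(N + 1) + k = (N + 1) + d" using N[rule_format, of "N + 1"] by linarith
  then show "a dvd k" using d by simp
next
  assume "a dvd k"
  moreover have "bij (\<lambda>z::int. z + k)"
    by (rule bij_betw_byWitness[where f' = "\<lambda>z. z - k"]) auto
  ultimately show "(\<lambda>z. z + k) \<in> drift_group a" by (auto simp: drift_group_def)
qed

lemma Alt_int_subset_drift_group: "Alt_int \<subseteq> drift_group a"
proof
  fix f assume f: "f \<in> Alt_int"
  then have "bdd_above {z. f z \<noteq> z}" by (simp add: Alt_int_def)
  then obtain N where "\<forall>z. f z \<noteq> z \<longrightarrow> z \<le> N" by (auto simp: bdd_above_def)
  then have "\<forall>z>N. f z = z + 0" by auto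
  then show "f \<in> drift_group a"
    using f unfolding drift_group_def Alt_int_def Sym_int_def by force
qed

section \<open>The groups generated by the alternating group and a translation\<close>

definition Alt_transl :: "int \<Rightarrow> (int \<Rightarrow> int) monoid" where
  "Alt_transl k = subgroup_generated Sym_int (Alt_int \<union> {\<lambda>z. z + k})"

lemma group_Alt_transl: "group (Alt_transl k)"
  unfolding Alt_transl_def by (rule group.group_subgroup_generated[OF group_Sym_int])

lemma generators_in_Alt_transl:
  "Alt_int \<subseteq> carrier (Alt_transl k)" "(\<lambda>z. z + k) \<in> carrier (Alt_transl k)"
proof -
  have "(\<lambda>z. z + k) \<in> carrier Sym_int"
    using translation_in_drift_group_iff[of k k] by (simp add: drift_group_def Sym_int_def)
  then have "Alt_int \<union> {\<lambda>z. z + k} \<subseteq> carrier Sym_int"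
    by (auto simp: Alt_int_def)
  from group.subgroup_generated_subset_carrier_subset[OF group_Sym_int this]
  show "Alt_int \<subseteq> carrier (Alt_transl k)" "(\<lambda>z. z + k) \<in> carrier (Alt_transl k)"
    by (auto simp: Alt_transl_def)
qed

lemma Alt_transl_minimal:
  assumes "subgroup H Sym_int" "Alt_int \<subseteq> H" "(\<lambda>z. z + k) \<in> H"
  shows "carrier (Alt_transl k) \<subseteq> H"
  unfolding Alt_transl_def
  by (rule group.subgroup_generated_minimal[OF group_Sym_int assms(1)]) (use assms in auto)

text \<open>Generation inside the subgroup is tested against subgroups of the ambient symmetric group, so
  that the obstructions need not be contained in the group itself.\<close>

lemma generate_Alt_transl_subset:
  assumes H: "subgroup H Sym_int" and X: "X \<subseteq> H" "X \<subseteq> carrier (Alt_transl k)"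
  shows "generate (Alt_transl k) X \<subseteq> H"
proof -
  have "subgroup (carrier (Alt_transl k)) Sym_int"
    unfolding Alt_transl_def carrier_subgroup_generated
    by (rule group.generate_is_subgroup[OF group_Sym_int]) auto
  then have "subgroup (carrier (Alt_transl k) \<inter> H) (Alt_transl k)"
    using group.subgroups_Inter_pair[OF group_Sym_int _ H]
    by (simp add: Alt_transl_def group.subgroup_subgroup_generated_iff[OF group_Sym_int])
  then have "generate (Alt_transl k) X \<subseteq> carrier (Alt_transl k) \<inter> H"
    using X by (intro group.generate_subgroup_incl[OF group_Alt_transl]) auto
  then show ?thesis by auto
qed

section \<open>Cycles of length three\<close>

definition three_cycle :: "int \<Rightarrow> int \<Rightarrow> int \<Rightarrow> int \<Rightarrow> int" where
  "three_cycle a b c = Transposition.transpose a b \<circ> Transposition.transpose b c"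

lemma three_cycle_simps:
  assumes "a \<noteq> b" "b \<noteq> c" "a \<noteq> c"
  shows "three_cycle a b c a = b" "three_cycle a b c b = c" "three_cycle a b c c = a"
    "z \<notin> {a, b, c} \<Longrightarrow> three_cycle a b c z = z"
  using assms by (auto simp: three_cycle_def Transposition.transpose_def)

lemma three_cycle_in_Alt_int:
  assumes "a \<noteq> b" "b \<noteq> c" "a \<noteq> c"
  shows "three_cycle a b c \<in> Alt_int"
proof -
  have "{z. three_cycle a b c z \<noteq> z} \<subseteq> {a, b, c}"
    using three_cycle_simps(4)[OF assms] by blast
  then have "finite {z. three_cycle a b c z \<noteq> z}"
    by (rule finite_subset) simp
  moreover have "bij (three_cycle a b c)"
    by (simp add: three_cycle_def bij_comp)
  moreover have "evenperm (three_cycle a b c)"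
    using assms by (simp add: three_cycle_def evenperm_comp permutation_swap_id evenperm_swap)
  ultimately show ?thesis
    by (simp add: Alt_int_def Sym_int_def)
qed

lemma three_cycle_image:
  assumes "{a, b, c} \<subseteq> A \<or> {a, b, c} \<inter> A = {}"
  shows "three_cycle a b c ` A = A"
proof -
  have "Transposition.transpose a b ` A = A" "Transposition.transpose b c ` A = A"
    using assms by (auto intro!: transpose_image_eq)
  then show ?thesis by (simp only: three_cycle_def image_comp[symmetric])
qed

text \<open>The spacing \<open>2 * k\<close> keeps the three points in one parity class of every element of drift
  \<open>\<plusminus>k\<close>, provided that \<open>M\<close> is large.\<close>

definition spaced_cycle :: "int \<Rightarrow> int \<Rightarrow> int \<Rightarrow> int" where
  "spaced_cycle k M = three_cycle (2*k*M) (2*k*(M+1)) (2*k*(M+2))"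

lemma spaced_cycle_in_Alt_int:
  assumes "k > 0"
  shows "spaced_cycle k M \<in> Alt_int"
  unfolding spaced_cycle_def by (rule three_cycle_in_Alt_int) (use assms in auto)

section \<open>Parity classes of an eventual translation\<close>

text \<open>The set \<open>E i\<close> collects the points whose forward orbit is, after some number \<open>n\<close> of steps,
  above \<open>N\<close> and in the residue class of \<open>(n + i) * k\<close> modulo \<open>2 * k\<close>. Each further step adds \<open>k\<close>, so
  the choice of \<open>n\<close> does not matter. From \<open>h z\<close> the same place is reached one step earlier
  than from \<open>z\<close>, so \<open>h\<close> maps \<open>E i\<close> onto \<open>E (i + 1)\<close>, and
  the index matters only modulo 2. Points whose forward orbit never enters the range
  above \<open>N\<close>, such as those on finite cycles, belong to no \<open>E i\<close>; \<open>A\<close> and \<open>B\<close>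
  need not cover the integers.\<close>

lemma parity_classes_forward:
  fixes h :: "int \<Rightarrow> int"
  assumes h: "bij h" "\<forall>z>N. h z = z + k" and k: "k > 0"
  obtains A B where "h ` A = B" "h ` B = A"
    "\<forall>z>N. z \<in> A \<longleftrightarrow> 2 * k dvd z" "\<forall>z>N. z \<in> B \<longleftrightarrow> 2 * k dvd z - k"
proof -
  define E where "E i = {z. \<exists>n. (h ^^ n) z > N \<and> 2 * k dvd (h ^^ n) z - (int n + i) * k}" for i
  have image: "h ` E i = E (i + 1)" for i
  proof
    show "h ` E i \<subseteq> E (i + 1)"
    proof
      fix w assume "w \<in> h ` E i"
      then obtain z n where w: "w = h z" and n: "(h ^^ n) z > N"
          "2 * k dvd (h ^^ n) z - (int n + i) * k"
        by (auto simp: E_def)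
      have "(h ^^ n) w = (h ^^ n) z + k"
        using h n by (simp add: w funpow_swap1[symmetric])
      then have "(h ^^ n) w > N \<and> 2 * k dvd (h ^^ n) w - (int n + (i + 1)) * k"
        using n k by (simp add: algebra_simps)
      then show "w \<in> E (i + 1)" by (auto simp: E_def)
    qed
    show "E (i + 1) \<subseteq> h ` E i"
    proof
      fix w assume w: "w \<in> E (i + 1)"
      obtain z where z: "w = h z" using h by (metis bij_pointE)
      obtain n where "(h ^^ n) w > N" "2 * k dvd (h ^^ n) w - (int n + (i + 1)) * k"
        using w by (auto simp: E_def)
      then have "(h ^^ Suc n) z > N \<and> 2 * k dvd (h ^^ Suc n) z - (int (Suc n) + i) * k"
        unfolding z funpow_Suc_right by (simp add: algebra_simps)
      then have "z \<in> E i" unfolding E_def by blast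
      then show "w \<in> h ` E i" by (simp add: z)
    qed
  qed
  have period: "E 2 = E 0"
  proof -
    have "2 * k dvd x - (int n + 2) * k \<longleftrightarrow> 2 * k dvd x - (int n + 0) * k" for x n
    proof -
      have "x - (int n + 0) * k = x - (int n + 2) * k + 2 * k" by (simp add: algebra_simps)
      then show ?thesis by (metis dvd_add_left_iff dvd_refl)
    qed
    then show ?thesis by (simp only: E_def)
  qed
  have mem: "z \<in> E i \<longleftrightarrow> 2 * k dvd z - i * k" if z: "z > N" for z i
  proof -
    have "(h ^^ n) z = z + int n * k" for n
    proof (induction n)
      case (Suc n)
      have "int n * k \<ge> 0" using k by simp
      then have "z + int n * k > N" using z by linarith
      then show ?case using Suc h by (simp add: algebra_simps)
    qed simp
    then have "z \<in> E i \<longleftrightarrow> (\<exists>n. z + int n * k > N \<and> 2 * k dvd z - i * k)"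
      by (simp add: E_def algebra_simps)
    then show ?thesis using z by (auto intro: exI[of _ 0])
  qed
  show ?thesis
  proof (rule that)
    show "h ` E 0 = E 1" "h ` E 1 = E 0"
      using image[of 0] image[of 1] period by simp_all
  qed (use mem[of _ 0] mem[of _ 1] in simp_all)
qed

text \<open>A drift of \<open>- k\<close> reduces to a drift of \<open>k\<close>: the pair for \<open>h\<inverse>\<close> also serves \<open>h\<close>, because the
  condition of being exchanged is symmetric.\<close>

lemma parity_classes:
  fixes h :: "int \<Rightarrow> int"
  assumes h: "bij h" "\<forall>z>N. h z = z + d" and k: "k > 0" and d: "\<bar>d\<bar> = k"
  obtains A B N' where "h ` A = B" "h ` B = A"
    "\<forall>z>N'. z \<in> A \<longleftrightarrow> 2 * k dvd z" "\<forall>z>N'. z \<in> B \<longleftrightarrow> 2 * k dvd z - k"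
proof (cases "d = k")
  case True
  show ?thesis
    by (rule parity_classes_forward[OF h(1) h(2)[unfolded True] k]) (rule that)
next
  case False
  then have d: "d = - k" using d by auto
  have "inv_into UNIV h z = z + k" if "z > N" for z
    using h that k by (intro inv_f_eq) (auto simp: d bij_is_inj)
  then obtain A B where AB: "inv_into UNIV h ` A = B" "inv_into UNIV h ` B = A"
    "\<forall>z>N. z \<in> A \<longleftrightarrow> 2 * k dvd z" "\<forall>z>N. z \<in> B \<longleftrightarrow> 2 * k dvd z - k"
    using parity_classes_forward[OF bij_imp_bij_inv[OF h(1)] _ k] by metis
  have "h ` (inv_into UNIV h ` C) = C" for C
    using h by (simp add: image_f_inv_f bij_is_surj)
  then show ?thesis using AB that[of A B N] by metis
qed

section \<open>Far-out 3-cycles defeat finite sets\<close>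

text \<open>The case distinction is on the drift \<open>d\<close> of \<open>h\<close>. Since \<open>k dvd d\<close> always holds, \<open>d dvd k\<close>
  singles out \<open>d = \<plusminus>k\<close>; in the other case, including \<open>d = 0\<close>, the drift group of \<open>d\<close>
  omits the translation by \<open>k\<close>.\<close>

lemma eventually_spaced_cycle_not_generating:
  assumes k: "k > 0" and h: "h \<in> carrier (Alt_transl k)"
  shows "\<forall>\<^sub>F M in at_top. generate (Alt_transl k) {spaced_cycle k M, h} \<noteq> carrier (Alt_transl k)"
proof -
  note g_Alt = spaced_cycle_in_Alt_int[OF k]
  have carr: "{spaced_cycle k M, h} \<subseteq> carrier (Alt_transl k)" for M
    using g_Alt generators_in_Alt_transl(1) h by auto
  have not_all: "generate (Alt_transl k) {spaced_cycle k M, h} \<noteq> carrier (Alt_transl k)"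
    if "subgroup H Sym_int" "spaced_cycle k M \<in> H" "h \<in> H" "f \<in> carrier (Alt_transl k)" "f \<notin> H" for H M f
    using generate_Alt_transl_subset[OF that(1) _ carr] that by auto
  have "carrier (Alt_transl k) \<subseteq> drift_group k"
    by (rule Alt_transl_minimal)
      (simp_all add: subgroup_drift_group Alt_int_subset_drift_group translation_in_drift_group_iff)
  then obtain d N where bij: "bij h" and kd: "k dvd d" and N: "\<forall>z>N. h z = z + d"
    using h by (auto simp: drift_group_def)
  show ?thesis
  proof (cases "d dvd k")
    case False
    have "h \<in> drift_group d"
      using bij N unfolding drift_group_def by (intro CollectI conjI exI[of _ d] exI[of _ N]) simp_all
    then have "generate (Alt_transl k) {spaced_cycle k M, h} \<noteq> carrier (Alt_transl k)" for M
      using g_Alt[of M] Alt_int_subset_drift_group False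
      by (intro not_all[OF subgroup_drift_group[of d] _ _ generators_in_Alt_transl(2)])
        (auto simp: translation_in_drift_group_iff)
    then show ?thesis by simp
  next
    case True
    then have "\<bar>d\<bar> = k" using kd k by (metis abs_of_pos zdvd_antisym_abs)
    then obtain A B N' where AB: "h ` A = B" "h ` B = A"
      "\<forall>z>N'. z \<in> A \<longleftrightarrow> 2 * k dvd z" "\<forall>z>N'. z \<in> B \<longleftrightarrow> 2 * k dvd z - k"
      using parity_classes[OF bij N k] by metis
    have "generate (Alt_transl k) {spaced_cycle k M, h} \<noteq> carrier (Alt_transl k)" if M: "M > max 0 N'" for M
    proof (rule not_all[OF subgroup_setwise_stabiliser[of "{A, B}"]])
      have ndvd: "\<not> 2 * k dvd 2 * k * m - k" "\<not> 2 * k dvd 2 * k * m + k" for m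
      proof -
        have "\<not> 2 * k dvd k" using k by (auto dest: zdvd_imp_le)
        then show "\<not> 2 * k dvd 2 * k * m - k" "\<not> 2 * k dvd 2 * k * m + k"
          by (metis dvd_diff_right_iff dvd_triv_left) (metis \<open>\<not> 2 * k dvd k\<close> dvd_add_right_iff dvd_triv_left)
      qed
      have large: "2 * k * m > N'" if "m \<ge> M" for m
      proof -
        have "1 * m \<le> 2 * k * m" using k M that by (intro mult_right_mono) auto
        then show ?thesis using M that by linarith
      qed
      have even_mem: "2 * k * m \<in> A" "2 * k * m \<notin> B" if "m \<ge> M" for m
        using AB(3,4) large[OF that] ndvd(1) by auto
      have "2 * k * M + k > N'" using large[of M] k by simp
      then have odd_mem: "2 * k * M + k \<notin> A"
        using AB(3) ndvd(2) by auto
      have "spaced_cycle k M ` A = A" "spaced_cycle k M ` B = B"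
        unfolding spaced_cycle_def
        using even_mem[of M] even_mem[of "M + 1"] even_mem[of "M + 2"]
        by (simp_all add: three_cycle_image)
      then show "spaced_cycle k M \<in> setwise_stabiliser {A, B}"
        using g_Alt by (simp add: setwise_stabiliser_def Alt_int_def Sym_int_def)
      show "h \<in> setwise_stabiliser {A, B}"
        using AB bij by (auto simp: setwise_stabiliser_def)
      \<comment> \<open>\<open>?u\<close> sends \<open>2*k*M \<in> A\<close> outside \<open>A\<close> and \<open>2*k*(M+1) \<in> A\<close> outside \<open>B\<close>, so \<open>?u ` A\<close> is neither.\<close>
      let ?u = "three_cycle (2*k*M) (2*k*M + k) (2*k*(M+1))"
      have u: "2*k*M \<noteq> 2*k*M + k" "2*k*M + k \<noteq> 2*k*(M+1)" "2*k*M \<noteq> 2*k*(M+1)"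
        using k by (auto simp: algebra_simps)
      show "?u \<in> carrier (Alt_transl k)"
        using three_cycle_in_Alt_int[OF u] generators_in_Alt_transl(1) by blast
      have "?u ` A \<noteq> A"
        using odd_mem even_mem(1)[of M] three_cycle_simps(1)[OF u] by (metis imageI order_refl)
      moreover have "?u ` A \<noteq> B"
        using even_mem(1)[of "M+1"] even_mem(2)[of M] three_cycle_simps(3)[OF u]
        by (metis imageI zle_add1_eq_le less_add_one order_less_imp_le)
      ultimately show "?u \<notin> setwise_stabiliser {A, B}"
        by (intro not_in_setwise_stabiliser[of A]) simp_all
    qed
    then show ?thesis
      unfolding eventually_at_top_dense by (intro exI[of _ "max 0 N'"]) simp
  qed
qed

theorem no_finite_total_dominating_set_Alt_transl:
  assumes k: "k > 0" and S: "finite S"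
  shows "\<not> total_dominating_set (Alt_transl k) S"
proof
  assume tds: "total_dominating_set (Alt_transl k) S"
  have "\<forall>h\<in>S. \<forall>\<^sub>F M in at_top. generate (Alt_transl k) {spaced_cycle k M, h} \<noteq> carrier (Alt_transl k)"
    using eventually_spaced_cycle_not_generating[OF k] tds
    unfolding total_dominating_set_def by blast
  then have "\<forall>\<^sub>F M in at_top. \<forall>h\<in>S. generate (Alt_transl k) {spaced_cycle k M, h} \<noteq> carrier (Alt_transl k)"
    by (intro eventually_ball_finite S)
  then obtain M where M: "\<forall>h\<in>S. generate (Alt_transl k) {spaced_cycle k M, h} \<noteq> carrier (Alt_transl k)"
    by (auto simp: eventually_at_top_linorder)
  have "spaced_cycle k M \<noteq> id"
    using three_cycle_simps(1)[of "2*k*M" "2*k*(M+1)" "2*k*(M+2)"] k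
    by (auto simp: spaced_cycle_def)
  then have "spaced_cycle k M \<noteq> \<one>\<^bsub>Alt_transl k\<^esub>"
    by (simp add: Alt_transl_def Sym_int_def)
  moreover have "spaced_cycle k M \<in> carrier (Alt_transl k)"
    using spaced_cycle_in_Alt_int[OF k] generators_in_Alt_transl(1) by blast
  ultimately show False
    using tds M unfolding total_dominating_set_def by blast
qed

lemma G1_eq: "G1 = Alt_transl 1"
proof -
  have "transl = (\<lambda>z. z + 1)" by (simp add: fun_eq_iff transl_def)
  then show ?thesis by (simp add: G1_def Alt_transl_def)
qed

lemma G2_eq: "G2 = Alt_transl 2"
proof -
  have "transl [^]\<^bsub>Sym_int\<^esub> (2::nat) = (\<lambda>z. z + 2)" by (simp add: fun_eq_iff transl_square)
  then show ?thesis by (simp add: G2_def Alt_transl_def)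
qed

theorem proposition5p5:
  "(\<nexists>S. finite S \<and> total_dominating_set G1 S) \<and>
   (\<nexists>S. finite S \<and> total_dominating_set G2 S)"
  using no_finite_total_dominating_set_Alt_transl[of 1] no_finite_total_dominating_set_Alt_transl[of 2]
  by (auto simp: G1_eq G2_eq)

end
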